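(* Let $\nu\geq1$, $0\leq\alpha<d$ and $1\leq p\leq q<\infty$ with $\frac{1}{q}+\frac{\alpha}{d}=\frac{1}{p}$. If $\Phi$ is an increasing function such that $$\|\mathcal{A}_{\alpha,\nu}^{\mathcal{S}}\|_{L^{p}(w^{p})\rightarrow L^{q,\infty}(w^{q})}\leq\Phi([w]_{A_{p,q}})$$ for all $w\in A_{p,q}$ and all sparse collections $\mathcal{S}$ of dyadic cubes in $\mathbb{R}^d$, then $\Phi(t)\gtrsim t^{\frac{1}{\nu}-\frac{\alpha}{d}}$, that is, there is a constant $c>0$ such that $\Phi(t)\ge c\,t^{\frac1\nu-\frac\alpha d}$ for all $t\ge 1$.
   Context: A weight on $\mathbb{R}^d$ is a locally integrable function $w:\mathbb{R}^d\to(0,\infty)$; $L^p(w^p)$ and $L^{q,\infty}(w^q)$ are taken with respect to the measures $w^p\,dx$ and $w^q\,dx$. Dyadic cubes are those of a fixed dyadic grid on $\mathbb{R}^d$. A collection $\mathcal{S}$ of dyadic cubes is sparse (with fixed parameter $0<\gamma<1$) if for each $Q\in\mathcal{S}$ there is $E_Q\subset Q$ with $|E_Q|\geq\gamma|Q|$, the sets $E_Q$, $Q\in\mathcal S$, being pairwise disjoint. For nonnegative $f$ set $$\langle f\rangle_{\alpha,Q}=\frac{1}{|Q|^{1-\alpha/d}}\int_Q f,\qquad \mathcal{A}_{\alpha,\nu}^{\mathcal{S}}(f)=\Big(\sum_{Q\in\mathcal{S}}\langle f\rangle_{\alpha,Q}^{\nu}\mathbf{1}_Q\Big)^{1/\nu}.$$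 The norm $\|\mathcal{A}_{\alpha,\nu}^{\mathcal{S}}\|_{L^{p}(w^{p})\rightarrow L^{q,\infty}(w^{q})}$ is the least $C\in[0,\infty]$ with $\|\mathcal{A}_{\alpha,\nu}^{\mathcal{S}}(f)\|_{L^{q,\infty}(w^q)}\le C\|f\|_{L^p(w^p)}$ for all nonnegative $f\in L^p(w^p)$. With $1/p+1/p'=1$, $$[w]_{A_{p,q}}=\sup_Q\Big(\frac{1}{|Q|}\int_Q w^q\Big)\Big(\frac{1}{|Q|}\int_Q w^{-p'}\Big)^{q/p'},$$ the supremum being over dyadic cubes, where for $p=1$ ($p'=\infty$) the second factor is understood as $\|w^{-1}\|_{L^\infty(Q)}^{q}$; $w\in A_{p,q}$ means $[w]_{A_{p,q}}<\infty$. Note $[w]_{A_{p,q}}\ge1$ always. *)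

theory Defs
  imports "HOL-Probability.Essential_Supremum" "HOL-Library.Disjoint_Sets"
begin

text \<open>Real powers of extended nonnegative numbers; used only with exponent \<open>a > 0\<close>,
  where \<open>0 powr a = 0\<close> and \<open>\<infinity> powr a = \<infinity>\<close> are the right conventions.\<close>

definition epowr :: "ennreal \<Rightarrow> real \<Rightarrow> ennreal" where
  "epowr x a = (if x = \<infinity> then \<infinity> else ennreal (enn2real x powr a))"


section \<open>Dyadic grids and sparse collections\<close>

definition cube :: "real ^ 'n \<Rightarrow> real \<Rightarrow> (real ^ 'n) set" where
  "cube a l = {x. \<forall>i. a $ i \<le> x $ i \<and> x $ i < a $ i + l}"

text \<open>Half-open cubes of side lengths \<open>2\<^sup>k\<close>, \<open>k \<in> \<int>\<close>, pairwise nested or disjoint,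
  the cubes of each fixed side length forming a partition of the whole space.\<close>

definition dyadic_grid :: "(real ^ 'n) set set \<Rightarrow> bool" where
  "dyadic_grid D \<longleftrightarrow>
     (\<forall>Q\<in>D. \<exists>a (k::int). Q = cube a (2 powi k)) \<and>
     (\<forall>Q\<in>D. \<forall>R\<in>D. Q \<inter> R \<in> {{}, Q, R}) \<and>
     (\<forall>k::int. partition_on UNIV {Q \<in> D. \<exists>a. Q = cube a (2 powi k)})"

lemma cube_std: "x \<in> cube (\<chi> i. 2 powi k * of_int (m $ i)) (2 powi k) \<longleftrightarrow>
   (\<forall>i. \<lfloor>x $ i / 2 powi k\<rfloor> = m $ i)"
proof -
  have "(0::real) < 2 powi k" by simp
  then have "(2 powi k * of_int (m $ i) \<le> x $ i \<and> x $ i < 2 powi k * of_int (m $ i) + 2 powi k) \<longleftrightarrow> \<lfloor>x $ i / 2 powi k\<rfloor> = m $ i" for i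
    unfolding floor_eq_iff by (simp add: field_simps)
  then show ?thesis by (simp add: cube_def)
qed

lemma floor_scale:
  assumes "k \<le> l" shows "\<lfloor>(y::real) / 2 powi l\<rfloor> = \<lfloor>y / 2 powi k\<rfloor> div 2 ^ nat (l - k)"
proof -
  have "(2::real) powi l = 2 powi (k + (l - k))" by simp
  also have "\<dots> = 2 powi k * 2 powi (l - k)" by (rule power_int_add) simp
  also have "(2::real) powi (l - k) = of_int (2 ^ nat (l - k))" using assms by (simp add: power_int_def)
  finally have "y / 2 powi l = (y / 2 powi k) / of_int (2 ^ nat (l - k))" by simp
  then show ?thesis by (simp only: floor_divide_real_eq_div zero_le_power zero_le_numeral)
qed

lemma cube_side:
  assumes "cube (a::real^'n) l = cube b l'" "0 < l" "0 < l'"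
  shows "l = l' \<and> a = b"
proof -
  have *: "a $ i \<le> b $ i \<and> b $ i + l' \<le> a $ i + l" if "cube (b::real^'n) l' \<subseteq> cube a l" "0 < l'" for a b l l' i
  proof -
    have "b \<in> cube b l'" using that(2) by (simp add: cube_def)
    then have 1: "a $ i \<le> b $ i" "b $ i < a $ i + l" using that by (auto simp: cube_def)
    have "b $ i + l' \<le> a $ i + l"
    proof (rule ccontr)
      assume n: "\<not> ?thesis"
      have "(\<chi> j. if j = i then a $ i + l else b $ j) \<in> cube b l'"
        using n 1 that(2) by (auto simp: cube_def)
      then have "(\<chi> j. if j = i then a $ i + l else b $ j) \<in> cube a l" using that by auto
      then show False by (auto simp: cube_def dest: spec[of _ i])
    qed
    with 1 show ?thesis by simp
  qed
  have "a $ i = b $ i \<and> l = l'" for i using *[of b l' a l i] *[of a l b l' i] assms by auto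
  then show ?thesis by (simp add: vec_eq_iff)
qed

text \<open>The standard grid is an instance of the definition.\<close>

lemma dyadic_grid_standard:
  "dyadic_grid {cube (\<chi> i. 2 powi k * of_int (m $ i)) (2 powi k) | (k::int) (m :: int ^ 'n). True}"
    (is "dyadic_grid ?D")
proof -
  let ?c = "\<lambda>k (m :: int ^ 'n). cube (\<chi> i. 2 powi k * of_int (m $ i)) (2 powi k)"
  have sub: "?c k m \<subseteq> ?c l n" if kl: "k \<le> l" "?c k m \<inter> ?c l n \<noteq> {}" for k l m n
  proof -
    obtain x where "x \<in> ?c k m" "x \<in> ?c l n" using \<open>?c k m \<inter> ?c l n \<noteq> {}\<close> by blast
    then have "m $ i div 2 ^ nat (l - k) = n $ i" for i
      using kl(1) by (auto simp: cube_std floor_scale)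
    then show ?thesis using kl(1) by (auto simp: cube_std floor_scale)
  qed
  have nest: "?c k m \<inter> ?c l n \<in> {{}, ?c k m, ?c l n}" for k l m n
    using sub[of k l m n] sub[of l k n m] by (cases "k \<le> l") (auto simp: Int_commute)
  have lev: "{Q \<in> ?D. \<exists>a. Q = cube a (2 powi k)} = range (?c k)" for k
    by (auto dest!: cube_side)
  have "partition_on UNIV (range (?c k))" for k
  proof (rule partition_onI)
    have "x \<in> ?c k (\<chi> i. \<lfloor>x $ i / 2 powi k\<rfloor>)" for x unfolding cube_std by simp
    then show "\<Union>(range (?c k)) = UNIV" by blast
    show "disjnt P Q" if "P \<in> range (?c k)" "Q \<in> range (?c k)" "P \<noteq> Q" for P Q
      using that sub[of k k, OF order_refl] unfolding disjnt_def by blast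
    have "(\<chi> i. 2 powi k * of_int (m $ i)) \<in> ?c k m" for m by (simp add: cube_def)
    then show "{} \<notin> range (?c k)" by fastforce
  qed
  then show ?thesis unfolding dyadic_grid_def lev using nest by blast
qed

definition sparse_family :: "real \<Rightarrow> (real ^ 'n) set set \<Rightarrow> bool" where
  "sparse_family \<gamma> S \<longleftrightarrow>
     (\<exists>E. (\<forall>Q\<in>S. E Q \<in> sets lebesgue \<and> E Q \<subseteq> Q \<and>
                 emeasure lebesgue (E Q) \<ge> ennreal \<gamma> * emeasure lebesgue Q) \<and>
          disjoint_family_on E S)"


section \<open>Weights and weighted spaces\<close>

definition weight :: "(real ^ 'n \<Rightarrow> real) \<Rightarrow> bool" where
  "weight w \<longleftrightarrow> (\<forall>x. w x > 0) \<and> (\<forall>K. compact K \<longrightarrow> w absolutely_integrable_on K)"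

text \<open>The measure \<open>w\<^sup>r dx\<close>.\<close>

definition weighted_measure :: "(real ^ 'n \<Rightarrow> real) \<Rightarrow> real \<Rightarrow> (real ^ 'n) measure" where
  "weighted_measure w r = density lebesgue (\<lambda>x. ennreal (w x powr r))"

definition Lp_norm :: "'a measure \<Rightarrow> real \<Rightarrow> ('a \<Rightarrow> real) \<Rightarrow> ennreal" where
  "Lp_norm M p f = epowr (\<integral>\<^sup>+x. ennreal (\<bar>f x\<bar> powr p) \<partial>M) (1 / p)"

definition Lp_space :: "'a measure \<Rightarrow> real \<Rightarrow> ('a \<Rightarrow> real) set" where
  "Lp_space M p = {f \<in> borel_measurable M. Lp_norm M p f < \<infinity>}"

definition weak_Lq_norm :: "'a measure \<Rightarrow> real \<Rightarrow> ('a \<Rightarrow> ennreal) \<Rightarrow> ennreal" where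
  "weak_Lq_norm M q g =
     (SUP t\<in>{0::real<..}. ennreal t * epowr (emeasure M {x \<in> space M. g x > ennreal t}) (1 / q))"

text \<open>For the sparse operators the infimum is attained: \<open>C \<mapsto> C * L\<close> is continuous for
  \<open>0 < L < \<infinity>\<close>, and \<open>f\<close> of norm 0 vanishes almost everywhere, so its image is 0.\<close>

definition strong_weak_norm ::
    "real \<Rightarrow> real \<Rightarrow> (real ^ 'n \<Rightarrow> real) \<Rightarrow> ((real ^ 'n \<Rightarrow> real) \<Rightarrow> real ^ 'n \<Rightarrow> ennreal) \<Rightarrow> ennreal"
  where
  "strong_weak_norm p q w T =
     Inf {C. \<forall>f\<in>Lp_space (weighted_measure w p) p. (\<forall>x. f x \<ge> 0) \<longrightarrow>
               weak_Lq_norm (weighted_measure w q) q (T f)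
                 \<le> C * Lp_norm (weighted_measure w p) p f}"

text \<open>For \<open>p > 1\<close> the conjugate exponent is \<open>p' = p / (p - 1)\<close>.\<close>

definition Apq_const ::
    "(real ^ 'n) set set \<Rightarrow> real \<Rightarrow> real \<Rightarrow> (real ^ 'n \<Rightarrow> real) \<Rightarrow> ennreal" where
  "Apq_const D p q w =
     (SUP Q\<in>D. (\<integral>\<^sup>+x\<in>Q. ennreal (w x powr q) \<partial>lebesgue) / emeasure lebesgue Q *
       (if p = 1 then
          epowr (esssup (restrict_space lebesgue Q) (\<lambda>x. ennreal (inverse (w x)))) q
        else
          (let p' = p / (p - 1) in
             epowr ((\<integral>\<^sup>+x\<in>Q. ennreal (w x powr (- p')) \<partial>lebesgue) / emeasure lebesgue Q)
                   (q / p'))))"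


section \<open>Sparse operators\<close>

definition frac_avg :: "real \<Rightarrow> (real ^ 'n) set \<Rightarrow> (real ^ 'n \<Rightarrow> real) \<Rightarrow> ennreal" where
  "frac_avg \<alpha> Q f =
     (\<integral>\<^sup>+x\<in>Q. ennreal (f x) \<partial>lebesgue) /
       ennreal (measure lebesgue Q powr (1 - \<alpha> / real CARD('n)))"

definition sparse_op ::
    "real \<Rightarrow> real \<Rightarrow> (real ^ 'n) set set \<Rightarrow> (real ^ 'n \<Rightarrow> real) \<Rightarrow> real ^ 'n \<Rightarrow> ennreal" where
  "sparse_op \<alpha> \<nu> S f x =
     epowr (\<Sum>\<^sub>\<infinity>Q\<in>S. epowr (frac_avg \<alpha> Q f) \<nu> * indicator Q x) (1 / \<nu>)"

end

theory Submission
  imports Defs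
begin

text \<open>
  Fix a unit cube of the grid with lower corner \<open>a\<close> and the nested cubes \<open>Q\<^sub>k\<close> of side \<open>2\<^sup>-\<^sup>k\<close> with the
  same corner, and let \<open>\<theta> = 2\<^sup>-\<^sup>d\<close>. The extremal weight is a dyadic version of
  \<open>w\<^sup>q = \<bar>x - a\<bar> powr (-d (1 - \<delta>))\<close>: on \<open>Q\<^sub>k - Q\<^sub>k\<^sub>+\<^sub>1\<close> put \<open>w\<^sup>q = (r/\<theta>)\<^sup>k\<close>, where
  \<open>r = 1 - (1 - \<theta>)/t\<close> is chosen so that \<open>\<integral>w\<^sup>q\<close> over \<open>Q\<^sub>k\<close> is exactly \<open>t r\<^sup>k\<close>. Its constant lies in \<open>[1, t]\<close>.
  The test function \<open>f = 2 powr (\<alpha> k)\<close> on \<open>Q\<^sub>k - Q\<^sub>k\<^sub>+\<^sub>1\<close> has all fractional averages over the \<open>Q\<^sub>k\<close>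
  at least 1, and \<open>\<parallel>f\<parallel>\<^sup>p \<le> (q/p) t\<close> because \<open>\<alpha>p/d + p/q = 1\<close>. For the sparse family of all
  \<open>Q\<^sub>m\<^sub>j\<close> with \<open>m\<close> fixed, the operator is at least \<open>(k+1) powr (1/\<nu>)\<close> on \<open>Q\<^sub>m\<^sub>k\<close>. With \<open>k = \<lfloor>t\<rfloor>\<close> the mass
  \<open>t r\<^sup>m\<^sup>k\<close> of \<open>Q\<^sub>m\<^sub>k\<close> is still comparable to \<open>t\<close>, so the norm is at least a multiple of
  \<open>t powr (1/\<nu> + 1/q - 1/p)\<close>.
\<close>

section \<open>Measure and corners of half-open cubes\<close>

lemma cube_measurable [measurable]: "cube a l \<in> sets borel"
  unfolding cube_def by measurable

lemma cube_lebesgue [measurable]: "cube a l \<in> sets lebesgue"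
  by (simp add: cube_measurable sets_completionI_sets)

text \<open>The half-open cube lies between the open and the closed box with the same corners, and
  both of these have volume \<open>l ^ CARD('n)\<close>.\<close>

lemma emeasure_cube:
  fixes a :: "real ^ 'n::finite"
  assumes "0 \<le> l"
  shows "emeasure lebesgue (cube a l) = ennreal (l ^ CARD('n))"
proof -
  let ?b = "a + (\<chi> i. l)"
  have prod: "(\<Prod>b\<in>Basis. (?b - a) \<bullet> b) = l ^ CARD('n)"
  proof -
    have "(\<Prod>b\<in>(Basis::(real^'n) set). (?b - a) \<bullet> b) = (\<Prod>b\<in>(Basis::(real^'n) set). l)"
      by (rule prod.cong) (auto simp: Basis_vec_def inner_axis)
    then show ?thesis by simp
  qed
  have le: "a \<bullet> b \<le> ?b \<bullet> b" if "b \<in> Basis" for b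
    using that assms by (auto simp: Basis_vec_def inner_axis)
  have "box a ?b \<subseteq> cube a l" "cube a l \<subseteq> cbox a ?b"
    by (auto simp: cube_def mem_box_cart less_imp_le)
  then have "emeasure lborel (box a ?b) \<le> emeasure lborel (cube a l)"
            "emeasure lborel (cube a l) \<le> emeasure lborel (cbox a ?b)"
    by (auto intro!: emeasure_mono simp: cube_measurable)
  moreover have "emeasure lborel (box a ?b) = ennreal (l ^ CARD('n))"
    using emeasure_lborel_box[of a ?b, OF le] by (simp only: prod)
  moreover have "emeasure lborel (cbox a ?b) = ennreal (l ^ CARD('n))"
    using emeasure_lborel_cbox[of a ?b, OF le] by (simp only: prod)
  ultimately have "emeasure lborel (cube a l) = ennreal (l ^ CARD('n))"
    by (intro antisym) simp_all
  then show ?thesis by (simp add: emeasure_completion cube_measurable)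
qed

lemma cube_subset_side:
  fixes a :: "real ^ 'n::finite"
  assumes "cube a l \<subseteq> cube b l'" "0 \<le> l" "0 \<le> l'"
  shows "l \<le> l'"
proof -
  have "emeasure lebesgue (cube a l) \<le> emeasure lebesgue (cube b l')"
    using assms by (intro emeasure_mono) (auto simp: cube_lebesgue)
  then have "l ^ CARD('n) \<le> l' ^ CARD('n)"
    unfolding emeasure_cube[OF assms(2)] emeasure_cube[OF assms(3)] using assms by simp
  then show ?thesis using assms by (simp add: power_mono_iff)
qed

text \<open>A half-open cube lies coordinatewise above its own corner, so the two memberships give
  both inequalities. This identifies the corner of a small grid cube through
  \<open>a\<close>.\<close>

lemma corner_antisym: "a \<in> cube b l \<Longrightarrow> b \<in> cube a l' \<Longrightarrow> a = b"
  unfolding cube_def vec_eq_iff by (blast intro: order_antisym)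

subsection \<open>Nested cubes with a common corner\<close>

definition dyad :: "real ^ 'n::finite \<Rightarrow> nat \<Rightarrow> (real ^ 'n) set" where
  "dyad a k = cube a ((1/2) ^ k)"

lemma dyad_lebesgue [measurable]: "dyad a k \<in> sets lebesgue"
  by (simp add: dyad_def)

lemma corner_in_dyad: "a \<in> dyad a k"
  by (simp add: dyad_def cube_def)

lemma dyad_antimono: "j \<le> k \<Longrightarrow> dyad a k \<subseteq> dyad a j"
proof -
  assume "j \<le> k"
  then have "(1/2::real) ^ k \<le> (1/2) ^ j" by (simp add: power_decreasing)
  then have "y < b + (1/2) ^ j" if "y < b + (1/2) ^ k" for y b :: real using that by linarith
  then show ?thesis unfolding dyad_def cube_def by blast
qed

lemma emeasure_dyad:
  "emeasure lebesgue (dyad (a :: real ^ 'n::finite) k) = ennreal (((1/2) ^ CARD('n)) ^ k)"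
  unfolding dyad_def by (subst emeasure_cube) (simp_all add: power_mult[symmetric] mult.commute)

lemma inj_dyad: "inj (dyad (a :: real ^ 'n::finite))"
proof (rule injI)
  fix j k assume "dyad a j = dyad a k"
  then have "(1/2::real) ^ j = (1/2) ^ k"
    using cube_side[of a "(1/2) ^ j" a "(1/2) ^ k"] by (simp add: dyad_def)
  then have "(2::real) ^ j = 2 ^ k" by (simp add: power_one_over)
  then show "j = k" by simp
qed

lemma in_all_dyads:
  assumes "\<And>k. x \<in> dyad a k" shows "x = (a :: real ^ 'n::finite)"
proof -
  have "x $ i = a $ i" for i
  proof (rule ccontr)
    assume "x $ i \<noteq> a $ i"
    moreover have "a $ i \<le> x $ i" using assms[of 0] by (simp add: dyad_def cube_def)
    ultimately have "0 < x $ i - a $ i" by simp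
    then obtain n where "(1/2::real) ^ n < x $ i - a $ i"
      using real_arch_pow_inv[of "x $ i - a $ i" "1/2"] by auto
    moreover have "x $ i < a $ i + (1/2) ^ n" using assms[of n] by (simp add: dyad_def cube_def)
    ultimately show False by simp
  qed
  then show ?thesis by (simp add: vec_eq_iff)
qed

text \<open>Vanishes outside \<open>dyad a 0\<close>; the value at \<open>a\<close> itself is junk.\<close>

definition lev :: "real ^ 'n::finite \<Rightarrow> real ^ 'n \<Rightarrow> nat" where
  "lev a x = (LEAST k. x \<notin> dyad a (Suc k))"

lemma lev_measurable [measurable]: "lev a \<in> measurable lebesgue (count_space UNIV)"
proof -
  have "(\<lambda>x. LEAST k. x \<notin> dyad a (Suc k)) \<in> measurable lebesgue (count_space UNIV)"
    by measurable
  then show ?thesis by (simp add: lev_def[abs_def])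
qed

lemma lev_shell:
  assumes "x \<in> dyad a k - dyad a (Suc k)" shows "lev a x = k"
  unfolding lev_def
proof (rule Least_equality)
  show "k \<le> j" if "x \<notin> dyad a (Suc j)" for j
    using assms that dyad_antimono[of "Suc j" k a] by (meson Diff_iff not_less_eq_eq subsetD)
qed (use assms in auto)

lemma lev_outside: "x \<notin> dyad a 0 \<Longrightarrow> lev a x = 0"
  using dyad_antimono[of 0 "Suc 0" a] unfolding lev_def by (intro Least_eq_0) auto

lemma lev_ge:
  assumes "x \<in> dyad a k" "x \<noteq> a" shows "k \<le> lev a x"
proof -
  obtain j where j: "x \<notin> dyad a (Suc j)"
    using assms(2) in_all_dyads[of x a] dyad_antimono[of _ "Suc _" a] by (meson le_SucI order_refl subsetD)
  then have "x \<notin> dyad a (Suc (lev a x))" unfolding lev_def by (rule LeastI)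
  then show ?thesis using assms(1) dyad_antimono[of "Suc (lev a x)" k a]
    by (meson not_less_eq_eq subsetD)
qed

text \<open>A point of \<open>dyad a n\<close> in none of the shells lies, by induction, in every
  nested cube, and only the corner does.\<close>

lemma dyad_minus_corner: "dyad a n - {a} = (\<Union>k. dyad a (k + n) - dyad a (Suc (k + n)))"
proof -
  have "x \<in> (\<Union>k. dyad a (k + n) - dyad a (Suc (k + n)))" if x: "x \<in> dyad a n" "x \<noteq> a" for x
  proof (rule ccontr)
    assume n: "\<not> ?thesis"
    have "x \<in> dyad a (k + n)" for k by (induction k) (use n x in auto)
    then have "x \<in> dyad a k" for k using dyad_antimono[of k "k + n" a] by auto
    then show False using in_all_dyads x by blast
  qed
  moreover have "dyad a (k + n) \<subseteq> dyad a n" for k by (rule dyad_antimono) simp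
  ultimately show ?thesis using corner_in_dyad by blast
qed

text \<open>General \<open>h\<close> serves two purposes: \<open>k + n\<close> for integrating over
  shells, and \<open>m * k\<close> for the disjoint sets witnessing sparseness.\<close>

lemma disjoint_shells:
  assumes "strict_mono (h :: nat \<Rightarrow> nat)"
  shows "disjoint_family (\<lambda>k. dyad a (h k) - dyad a (h (Suc k)))"
unfolding disjoint_family_on_def
proof (intro ballI impI)
  have *: "(dyad a (h j) - dyad a (h (Suc j))) \<inter> (dyad a (h k) - dyad a (h (Suc k))) = {}"
    if "j < k" for j k
    using dyad_antimono[of "h (Suc j)" "h k" a] that strict_mono_less_eq[OF assms, of "Suc j" k] by auto
  show "(dyad a (h j) - dyad a (h (Suc j))) \<inter> (dyad a (h k) - dyad a (h (Suc k))) = {}"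
    if "j \<noteq> k" for j k
    using *[of j k] *[of k j] that by (metis Int_commute linorder_neqE_nat)
qed

lemma AE_not_corner: "AE x in lebesgue. x \<noteq> (a :: real ^ 'n::finite)"
  by (rule AE_I[of _ _ "{a}"]) auto

lemma emeasure_dyad_diff:
  fixes a :: "real ^ 'n::finite"
  assumes "j \<le> k"
  shows "emeasure lebesgue (dyad a j - dyad a k) = ennreal (((1/2) ^ CARD('n)) ^ j - ((1/2) ^ CARD('n)) ^ k)"
proof -
  have "emeasure lebesgue (dyad a j - dyad a k) = emeasure lebesgue (dyad a j) - emeasure lebesgue (dyad a k)"
    by (rule emeasure_Diff) (auto simp: emeasure_dyad dyad_antimono assms)
  then show ?thesis by (simp add: emeasure_dyad ennreal_minus)
qed

text \<open>Up to the null corner, the integrand equals \<open>c ^ (k + n)\<close> on a shell of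
  measure \<open>(1 - \<theta>) * \<theta> ^ (k + n)\<close>, so the integral is a geometric series
  of ratio \<open>c * \<theta>\<close>. Every integral of the weight and of the test function
  reduces to this one.\<close>

lemma nn_integral_lev_power:
  fixes a :: "real ^ 'n::finite"
  defines "\<theta> \<equiv> (1/2) ^ CARD('n)"
  assumes "0 \<le> c" "c * \<theta> < 1"
  shows "(\<integral>\<^sup>+x\<in>dyad a n. ennreal (c ^ lev a x) \<partial>lebesgue)
           = ennreal ((1 - \<theta>) * (c * \<theta>) ^ n / (1 - c * \<theta>))"
proof -
  let ?B = "\<lambda>k. dyad a (k + n) - dyad a (Suc (k + n))"
  have th: "0 < \<theta>" "\<theta> < 1" by (auto simp: \<theta>_def power_less_one_iff)
  have "(\<integral>\<^sup>+x\<in>dyad a n. ennreal (c ^ lev a x) \<partial>lebesgue)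
      = (\<integral>\<^sup>+x\<in>(\<Union>k. ?B k). ennreal (c ^ lev a x) \<partial>lebesgue)"
    by (rule nn_integral_cong_AE)
       (use AE_not_corner[of a] in eventually_elim, simp add: dyad_minus_corner[symmetric] indicator_def)
  also have "\<dots> = (\<Sum>k. \<integral>\<^sup>+x\<in>?B k. ennreal (c ^ lev a x) \<partial>lebesgue)"
  proof (rule nn_integral_disjoint_family)
    show "disjoint_family ?B" using disjoint_shells[of "\<lambda>k. k + n" a] by (simp add: strict_mono_def)
  qed measurable
  also have "(\<lambda>k. \<integral>\<^sup>+x\<in>?B k. ennreal (c ^ lev a x) \<partial>lebesgue)
     = (\<lambda>k. ennreal ((1 - \<theta>) * (c * \<theta>) ^ n * (c * \<theta>) ^ k))"
  proof
    fix k
    have "(\<integral>\<^sup>+x\<in>?B k. ennreal (c ^ lev a x) \<partial>lebesgue)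
        = (\<integral>\<^sup>+x. ennreal (c ^ (k + n)) * indicator (?B k) x \<partial>lebesgue)"
      by (rule nn_integral_cong) (auto simp: indicator_def lev_shell)
    also have "\<dots> = ennreal (c ^ (k + n)) * emeasure lebesgue (?B k)"
      by (rule nn_integral_cmult_indicator) auto
    also have "emeasure lebesgue (?B k) = ennreal ((1 - \<theta>) * \<theta> ^ (k + n))"
      by (subst emeasure_dyad_diff) (auto simp: \<theta>_def algebra_simps)
    also have "ennreal (c ^ (k + n)) * \<dots> = ennreal ((1 - \<theta>) * (c * \<theta>) ^ n * (c * \<theta>) ^ k)"
      using assms th by (simp add: ennreal_mult[symmetric] power_add power_mult_distrib algebra_simps)
    finally show "(\<integral>\<^sup>+x\<in>?B k. ennreal (c ^ lev a x) \<partial>lebesgue) = \<dots>" .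
  qed
  also have "(\<Sum>k. ennreal ((1 - \<theta>) * (c * \<theta>) ^ n * (c * \<theta>) ^ k))
     = ennreal ((1 - \<theta>) * (c * \<theta>) ^ n / (1 - c * \<theta>))"
  proof (rule suminf_ennreal_eq)
    show "(\<lambda>k. (1 - \<theta>) * (c * \<theta>) ^ n * (c * \<theta>) ^ k) sums ((1 - \<theta>) * (c * \<theta>) ^ n / (1 - c * \<theta>))"
      using sums_mult[OF geometric_sums[of "c * \<theta>"], of "(1 - \<theta>) * (c * \<theta>) ^ n"] assms th by simp
  qed (use assms th in auto)
  finally show ?thesis .
qed

subsection \<open>Grid cubes and the corner\<close>

lemma two_powi_neg: "(2::real) powi (- int k) = (1/2) ^ k"
  by (simp add: power_int_minus power_one_over inverse_eq_divide)

text \<open>The grid cube of side \<open>(1/2) ^ k\<close> through \<open>a\<close> is nested with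
  \<open>dyad a 0\<close>. If it lies inside, its corner is at least \<open>a\<close> in each
  coordinate, and at most \<open>a\<close> because it contains \<open>a\<close>.\<close>

lemma dyad_in_grid:
  assumes D: "dyadic_grid D" and a: "dyad a 0 \<in> D"
  shows "dyad (a :: real ^ 'n::finite) k \<in> D"
proof -
  have "partition_on UNIV {Q \<in> D. \<exists>b. Q = cube b (2 powi (- int k))}"
    using D unfolding dyadic_grid_def by blast
  then have "a \<in> \<Union> {Q \<in> D. \<exists>b. Q = cube b (2 powi (- int k))}"
    by (simp add: partition_on_def)
  then obtain b where b: "cube b ((1/2) ^ k) \<in> D" "a \<in> cube b ((1/2) ^ k)"
    by (auto simp: two_powi_neg)
  let ?R = "cube b ((1/2) ^ k)"
  have a0: "a \<in> dyad a 0" by (rule corner_in_dyad)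
  have "?R \<inter> dyad a 0 \<in> {{}, ?R, dyad a 0}" using D a b unfolding dyadic_grid_def by blast
  then have "?R \<subseteq> dyad a 0 \<or> dyad a 0 \<subseteq> ?R" using b a0 by blast
  moreover have "?R \<subseteq> dyad a 0 \<Longrightarrow> ?thesis"
  proof -
    assume "?R \<subseteq> dyad a 0"
    moreover have "b \<in> ?R" by (simp add: cube_def)
    ultimately have "b \<in> dyad a 0" by blast
    then have "a = b" using b(2) corner_antisym by (metis dyad_def)
    then show ?thesis using b by (simp add: dyad_def)
  qed
  moreover have "dyad a 0 \<subseteq> ?R \<Longrightarrow> ?R = dyad a 0 \<or> ?thesis"
  proof -
    \<comment> \<open>This inclusion forces \<open>k = 0\<close>; two grid cubes of side 1 that
      share the point \<open>a\<close> coincide by the partition property.\<close>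
    assume sub: "dyad a 0 \<subseteq> ?R"
    then have "(1::real) \<le> (1/2) ^ k" using cube_subset_side[of a 1 b] by (simp add: dyad_def)
    then have "\<not> 0 < k" using power_strict_decreasing[of 0 k "1/2::real"] by auto
    then have "k = 0" by simp
    moreover have "\<exists>x. dyad a 0 = cube x (2 powi 0)" "\<exists>x. cube b 1 = cube x (2 powi 0)"
      by (auto simp: dyad_def)
    moreover have "partition_on UNIV {Q \<in> D. \<exists>b. Q = cube b (2 powi 0)}"
      using D unfolding dyadic_grid_def by blast
    ultimately have "?R \<inter> dyad a 0 = {}" if "?R \<noteq> dyad a 0"
      using a b(1) that disjointD[OF partition_onD2, of UNIV "{Q \<in> D. \<exists>b. Q = cube b (2 powi 0)}" ?R "dyad a 0"]
        \<open>k = 0\<close> by simp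
    then show ?thesis using a0 b(2) by blast
  qed
  ultimately show ?thesis by blast
qed

text \<open>A grid cube through \<open>a\<close> that lies in the unit cube has corner
  \<open>a\<close>, by the same two-sided comparison of corners. A larger one may have
  \<open>a\<close> anywhere inside, so only the inclusion is recorded.\<close>

lemma grid_cube_at_corner:
  assumes D: "dyadic_grid D" and a: "dyad a 0 \<in> D" and Q: "Q \<in> D" "(a :: real ^ 'n::finite) \<in> Q"
  shows "(\<exists>k. Q = dyad a k) \<or> dyad a 0 \<subseteq> Q"
proof -
  have "\<forall>Q\<in>D. \<exists>b (j::int). Q = cube b (2 powi j)" using D by (simp add: dyadic_grid_def)
  then obtain b and j :: int where bj: "Q = cube b (2 powi j)" using Q(1) by blast
  have pos: "0 < (2::real) powi j" by simp
  have "Q \<inter> dyad a 0 \<in> {{}, Q, dyad a 0}" using D a Q unfolding dyadic_grid_def by blast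
  then consider "Q \<subseteq> dyad a 0" | "dyad a 0 \<subseteq> Q" using Q corner_in_dyad[of a 0] by blast
  then show ?thesis
  proof cases
    case 1
    have "b \<in> Q" using pos by (simp add: bj cube_def)
    then have "b \<in> dyad a 0" using 1 by blast
    then have ab: "a = b" using Q(2) bj corner_antisym by (metis dyad_def)
    have "(2::real) powi j \<le> 1" using cube_subset_side[of b "2 powi j" a 1] 1 bj by (simp add: dyad_def)
    then have "\<not> 0 < j" using one_less_power_int[of "2::real" j] by auto
    then have j: "j = - int (nat (- j))" by simp
    then have "Q = dyad a (nat (- j))"
      unfolding bj ab dyad_def two_powi_neg[symmetric] using j by metis
    then show ?thesis by blast
  qed blast
qed

text \<open>A grid cube missing \<open>a\<close> contains none of the nested cubes, so it lies
  inside or outside each of them. Hence the weight is constant on it.\<close>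

lemma lev_const_on_grid_cube:
  assumes D: "dyadic_grid D" and a: "dyad a 0 \<in> D" and Q: "Q \<in> D" "(a :: real ^ 'n::finite) \<notin> Q"
    and xy: "x \<in> Q" "y \<in> Q"
  shows "lev a x = lev a y"
proof -
  have "x \<in> dyad a k \<longleftrightarrow> y \<in> dyad a k" for k
  proof -
    have "Q \<inter> dyad a k \<in> {{}, Q, dyad a k}"
      using D Q dyad_in_grid[OF D a, of k] unfolding dyadic_grid_def by blast
    moreover have "Q \<inter> dyad a k \<noteq> dyad a k" using Q(2) corner_in_dyad[of a k] by blast
    ultimately have "Q \<inter> dyad a k = {} \<or> Q \<inter> dyad a k = Q" by blast
    then show ?thesis using xy by blast
  qed
  then show ?thesis by (simp add: lev_def)
qed

subsection \<open>Weak-type norms and sparse operators\<close>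

lemma epowr_ennreal: "0 \<le> x \<Longrightarrow> epowr (ennreal x) a = ennreal (x powr a)"
  by (simp add: epowr_def)

lemma epowr_mono:
  assumes "x \<le> y" "0 \<le> a" shows "epowr x a \<le> epowr y a"
proof (cases "y = \<infinity>")
  case False
  then have "x \<noteq> \<infinity>" using assms(1) by (auto simp: top_unique)
  moreover have "enn2real x \<le> enn2real y"
    using assms(1) False by (intro enn2real_mono) (auto simp: less_top)
  ultimately show ?thesis using False assms(2)
    by (auto simp: epowr_def intro!: ennreal_leI powr_mono2)
qed (simp add: epowr_def)

lemma epowr_measurable [measurable (raw)]:
  assumes [measurable]: "g \<in> borel_measurable M"
  shows "(\<lambda>x. epowr (g x) a) \<in> borel_measurable M"
  unfolding epowr_def by measurable

text \<open>The weak norm uses strict superlevel sets, so it is tested at height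
  \<open>l / 2\<close>, where \<open>A\<close> is certainly included. The price is a factor
  2.\<close>

lemma weak_Lq_norm_ge:
  assumes "A \<in> sets M" "ennreal b \<le> emeasure M A" "0 \<le> b" "0 < l" "0 < q"
    and [measurable]: "g \<in> borel_measurable M" and "\<And>x. x \<in> A \<Longrightarrow> ennreal l \<le> g x"
  shows "ennreal (l / 2 * b powr (1 / q)) \<le> weak_Lq_norm M q g"
proof -
  let ?U = "{x \<in> space M. g x > ennreal (l / 2)}"
  have "ennreal (l / 2) < ennreal l" using assms by (simp add: ennreal_lessI)
  then have "A \<subseteq> ?U" using assms(1,7) sets.sets_into_space by fastforce
  then have "ennreal b \<le> emeasure M ?U" by (intro order_trans[OF assms(2)] emeasure_mono) measurable
  then have "ennreal (b powr (1 / q)) \<le> epowr (emeasure M ?U) (1 / q)"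
    using assms(3,5) epowr_mono[of "ennreal b" _ "1 / q"] by (simp add: epowr_ennreal)
  then have "ennreal (l / 2) * ennreal (b powr (1 / q)) \<le> ennreal (l / 2) * epowr (emeasure M ?U) (1 / q)"
    by (rule mult_left_mono) simp
  also have "\<dots> \<le> weak_Lq_norm M q g"
    unfolding weak_Lq_norm_def by (rule SUP_upper) (use assms in auto)
  finally show ?thesis using assms by (subst ennreal_mult) auto
qed

text \<open>Every admissible constant \<open>C\<close> satisfies \<open>K \<le> C * N\<close>, and
  division by \<open>N\<close> is legitimate in \<open>ennreal\<close> because \<open>N\<close> is
  positive and finite.\<close>

lemma strong_weak_norm_ge:
  assumes "f \<in> Lp_space (weighted_measure w p) p" "\<And>x. 0 \<le> f x"
    and "Lp_norm (weighted_measure w p) p f \<le> ennreal N" "0 < N"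
    and "ennreal K \<le> weak_Lq_norm (weighted_measure w q) q (T f)" "0 \<le> K"
  shows "ennreal (K / N) \<le> strong_weak_norm p q w T"
  unfolding strong_weak_norm_def
proof (rule Inf_greatest, clarify)
  fix C assume C: "\<forall>f\<in>Lp_space (weighted_measure w p) p. (\<forall>x. 0 \<le> f x) \<longrightarrow>
     weak_Lq_norm (weighted_measure w q) q (T f) \<le> C * Lp_norm (weighted_measure w p) p f"
  have "ennreal K \<le> C * Lp_norm (weighted_measure w p) p f"
    using C assms(1,2,5) order_trans by blast
  also have "\<dots> \<le> C * ennreal N" using assms(3) by (rule mult_left_mono) simp
  finally have "ennreal K / ennreal N \<le> C * ennreal N / ennreal N" by (rule divide_right_mono_ennreal)
  also have "\<dots> = C" using assms(4) by (intro ennreal_mult_divide_eq) auto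
  finally show "ennreal (K / N) \<le> C" using assms by (simp add: divide_ennreal)
qed

text \<open>The infinite sum is a supremum over the finite subfamilies of \<open>S\<close>, of which
  there are only countably many.\<close>

lemma sparse_op_measurable:
  assumes "countable S" "\<And>Q. Q \<in> S \<Longrightarrow> Q \<in> sets lebesgue"
  shows "sparse_op \<alpha> \<nu> S f \<in> borel_measurable lebesgue"
proof -
  have [measurable]: "(\<lambda>x. SUP F\<in>{F. finite F \<and> F \<subseteq> S}. \<Sum>Q\<in>F. epowr (frac_avg \<alpha> Q f) \<nu> * indicator Q x)
     \<in> borel_measurable lebesgue"
    using assms(2) countable_Collect_finite_subset[OF assms(1)]
    by (intro borel_measurable_SUP borel_measurable_sum borel_measurable_times borel_measurable_const
        borel_measurable_indicator) (auto simp: conj_commute)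
  show ?thesis
    unfolding sparse_op_def[abs_def] by (subst nonneg_infsum_complete) (simp, measurable)
qed

lemma sparse_op_ge:
  assumes "finite F" "F \<subseteq> S" "0 < \<nu>" and "\<And>Q. Q \<in> F \<Longrightarrow> 1 \<le> frac_avg \<alpha> Q f \<and> x \<in> Q"
  shows "ennreal (real (card F) powr (1 / \<nu>)) \<le> sparse_op \<alpha> \<nu> S f x"
proof -
  have "1 \<le> epowr (frac_avg \<alpha> Q f) \<nu> * indicator Q x" if "Q \<in> F" for Q
    using epowr_mono[of "ennreal 1" "frac_avg \<alpha> Q f" \<nu>] assms(3) assms(4)[OF that]
    by (simp only: epowr_ennreal zero_le_one) simp
  then have "(\<Sum>Q\<in>F. 1) \<le> (\<Sum>Q\<in>F. epowr (frac_avg \<alpha> Q f) \<nu> * indicator Q x)"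
    by (rule sum_mono)
  also have "\<dots> \<le> (\<Sum>\<^sub>\<infinity>Q\<in>S. epowr (frac_avg \<alpha> Q f) \<nu> * indicator Q x)"
    by (subst nonneg_infsum_complete) (use assms(1,2) in \<open>auto intro!: SUP_upper\<close>)
  finally have "ennreal (real (card F)) \<le> (\<Sum>\<^sub>\<infinity>Q\<in>S. epowr (frac_avg \<alpha> Q f) \<nu> * indicator Q x)"
    by (simp add: ennreal_of_nat_eq_real_of_nat)
  from epowr_mono[OF this, of "1 / \<nu>"] show ?thesis
    using assms(3) by (simp add: sparse_op_def epowr_ennreal)
qed

text \<open>Each cube keeps what remains after removing the next cube of the family, which takes
  away only the fraction \<open>\<theta> ^ m \<le> 1 - \<gamma>\<close>.\<close>

lemma sparse_family_dyads:
  fixes a :: "real ^ 'n::finite"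
  assumes "0 < m" and m: "((1/2) ^ CARD('n)) ^ m \<le> 1 - \<gamma>" and "0 \<le> \<gamma>"
  shows "sparse_family \<gamma> (range (\<lambda>k. dyad a (m * k)))"
proof -
  let ?h = "\<lambda>k. dyad a (m * k)" and ?\<theta> = "(1/2 :: real) ^ CARD('n)"
  let ?E = "\<lambda>k. ?h k - ?h (Suc k)"
  have h: "strict_mono (\<lambda>k. m * k)" using assms(1) by (simp add: strict_mono_def)
  have inj: "inj ?h"
    using inj_compose[OF inj_dyad strict_mono_imp_inj_on[OF h], of a] by (simp add: comp_def)
  have disj: "disjoint_family ?E" by (rule disjoint_shells[OF h])
  have size: "ennreal \<gamma> * emeasure lebesgue (?h k) \<le> emeasure lebesgue (?E k)" for k
  proof -
    have "\<gamma> * ?\<theta> ^ (m * k) \<le> (1 - ?\<theta> ^ m) * ?\<theta> ^ (m * k)"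
      using m by (intro mult_right_mono) auto
    also have "\<dots> = ?\<theta> ^ (m * k) - ?\<theta> ^ (m * Suc k)" by (simp add: power_add left_diff_distrib)
    finally have "ennreal (\<gamma> * ?\<theta> ^ (m * k)) \<le> ennreal (?\<theta> ^ (m * k) - ?\<theta> ^ (m * Suc k))"
      by (rule ennreal_leI)
    then have "ennreal \<gamma> * ennreal (?\<theta> ^ (m * k)) \<le> ennreal (?\<theta> ^ (m * k) - ?\<theta> ^ (m * Suc k))"
      by (subst ennreal_mult[symmetric]) (use assms(3) in auto)
    then show ?thesis
      by (subst emeasure_dyad_diff) (simp_all only: emeasure_dyad, simp)
  qed
  define E where "E = ?E"
  \<comment> \<open>Sparseness wants sets indexed by cubes rather than by numbers; injectivity
    recovers the index from the cube.\<close>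
  define idx where "idx = inv ?h"
  have idx: "idx (?h k) = k" for k using inv_f_f[OF inj, of k] by (simp only: idx_def)
  show ?thesis
    unfolding sparse_family_def
  proof (intro exI[of _ "\<lambda>Q. E (idx Q)"] conjI ballI)
    show "disjoint_family_on (\<lambda>Q. E (idx Q)) (range ?h)"
      unfolding disjoint_family_on_def
    proof (intro ballI impI)
      fix P Q assume PQ: "P \<in> range ?h" "Q \<in> range ?h" "P \<noteq> Q"
      then have "idx P \<noteq> idx Q" using idx by (metis rangeE)
      then show "E (idx P) \<inter> E (idx Q) = {}" using disj by (simp add: E_def disjoint_family_on_def)
    qed
  next
    fix Q assume "Q \<in> range ?h"
    then obtain k where k: "Q = ?h k" by blast
    show "E (idx Q) \<in> sets lebesgue" by (simp add: E_def)
    show "E (idx Q) \<subseteq> Q" by (simp add: k idx E_def Diff_subset)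
    show "ennreal \<gamma> * emeasure lebesgue Q \<le> emeasure lebesgue (E (idx Q))"
      using size[of k] by (simp only: k idx E_def)
  qed
qed

subsection \<open>The weight and the test function\<close>

lemma weight_lev:
  fixes a :: "real ^ 'n::finite"
  assumes v: "1 \<le> v" "v * (1/2) ^ CARD('n) < 1"
  shows "weight (\<lambda>x. v ^ lev a x)"
  unfolding weight_def
proof (intro conjI allI impI)
  show "0 < v ^ lev a x" for x using v by simp
  fix K :: "(real ^ 'n) set" assume K: "compact K"
  have [measurable]: "K \<in> sets lebesgue" using K by (simp add: borel_compact)
  \<comment> \<open>Off \<open>dyad a 0\<close> the weight is 1, so there the integral is controlled
    by the finite measure of \<open>K\<close>.\<close>
  have "(\<integral>\<^sup>+x. ennreal (norm (indicat_real K x *\<^sub>R v ^ lev a x)) \<partial>lebesgue)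
     \<le> (\<integral>\<^sup>+x. indicator K x + ennreal (v ^ lev a x) * indicator (dyad a 0) x \<partial>lebesgue)"
    using v by (intro nn_integral_mono) (auto simp: indicator_def lev_outside)
  also have "\<dots> = emeasure lebesgue K + (\<integral>\<^sup>+x\<in>dyad a 0. ennreal (v ^ lev a x) \<partial>lebesgue)"
    by (subst nn_integral_add) auto
  also have "\<dots> < \<infinity>"
    using v emeasure_compact_finite[OF K]
    by (subst nn_integral_lev_power) (auto simp: borel_compact[OF K])
  finally show "(\<lambda>x. v ^ lev a x) absolutely_integrable_on K"
    unfolding set_integrable_def by (intro integrableI_bounded) auto
qed

section \<open>Two-sided bounds for the constant of the weight\<close>

lemma emeasure_grid_cube:
  assumes "dyadic_grid D" "Q \<in> D"
  obtains m where "0 < m" "emeasure lebesgue Q = ennreal m" "Q \<in> sets lebesgue"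
proof -
  have "\<forall>Q\<in>D. \<exists>b (j::int). Q = cube b (2 powi j)" using assms(1) by (simp add: dyadic_grid_def)
  then obtain b and j :: int where "Q = cube b (2 powi j)" using assms(2) by blast
  moreover have "0 < (2::real) powi j" by simp
  ultimately show ?thesis using that[of "(2 powi j) ^ CARD('a)"] emeasure_cube[of "2 powi j" b]
    by (simp add: cube_lebesgue less_imp_le)
qed

text \<open>An \<open>A_1\<close>-type criterion for \<open>w powr q\<close>: a lower bound
  \<open>u\<close> for the weight on \<open>Q\<close> makes the second factor at most
  \<open>u powr (- q)\<close> both for \<open>p = 1\<close> and for \<open>p > 1\<close>, which
  cancels the \<open>u powr q\<close> in the bound for the first factor.\<close>

lemma Apq_const_le:
  fixes w :: "real ^ 'n::finite \<Rightarrow> real"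
  assumes D: "dyadic_grid D" and p: "1 \<le> p" and q: "0 < q"
    and [measurable]: "w \<in> borel_measurable lebesgue"
    and Q: "\<And>Q. Q \<in> D \<Longrightarrow> \<exists>u>0. (AE x in lebesgue. x \<in> Q \<longrightarrow> u \<le> w x) \<and>
        (\<integral>\<^sup>+x\<in>Q. ennreal (w x powr q) \<partial>lebesgue) \<le> ennreal (t * u powr q) * emeasure lebesgue Q"
    and t: "0 \<le> t"
  shows "Apq_const D p q w \<le> ennreal t"
  unfolding Apq_const_def
proof (rule SUP_least)
  fix Q assume QD: "Q \<in> D"
  obtain m where m: "0 < m" "emeasure lebesgue Q = ennreal m" and [measurable]: "Q \<in> sets lebesgue"
    using emeasure_grid_cube[OF D QD] by metis
  obtain u where u: "0 < u" "AE x in lebesgue. x \<in> Q \<longrightarrow> u \<le> w x"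
    and int: "(\<integral>\<^sup>+x\<in>Q. ennreal (w x powr q) \<partial>lebesgue) \<le> ennreal (t * u powr q) * ennreal m"
    using Q[OF QD] m by auto
  have avg: "I / emeasure lebesgue Q \<le> c" if "I \<le> c * ennreal m" for I c
    using divide_right_mono_ennreal[OF that, of "ennreal m"] ennreal_mult_divide_eq[of "ennreal m" c] m by simp
  let ?X = "if p = 1 then epowr (esssup (restrict_space lebesgue Q) (\<lambda>x. ennreal (inverse (w x)))) q
      else (let p' = p / (p - 1) in
        epowr ((\<integral>\<^sup>+x\<in>Q. ennreal (w x powr (- p')) \<partial>lebesgue) / emeasure lebesgue Q) (q / p'))"
  have "?X \<le> ennreal (u powr (- q))"
  proof (cases "p = 1")
    case True
    have [measurable]: "w \<in> borel_measurable (restrict_space lebesgue Q)"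
      by (rule measurable_restrict_space1) simp
    have "AE x in restrict_space lebesgue Q. ennreal (inverse (w x)) \<le> ennreal (inverse u)"
      using u by (subst AE_restrict_space_iff) (auto elim!: eventually_mono intro!: ennreal_leI le_imp_inverse_le)
    then have "esssup (restrict_space lebesgue Q) (\<lambda>x. ennreal (inverse (w x))) \<le> ennreal (inverse u)"
      by (intro esssup_I) measurable
    from epowr_mono[OF this, of q] show ?thesis
      using True q u by (simp add: epowr_ennreal powr_minus inverse_powr)
  next
    case False
    define p' where "p' = p / (p - 1)"
    have p': "0 < p'" using False p by (simp add: p'_def)
    have "(\<integral>\<^sup>+x\<in>Q. ennreal (w x powr (- p')) \<partial>lebesgue) \<le> (\<integral>\<^sup>+x\<in>Q. ennreal (u powr (- p')) \<partial>lebesgue)"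
    proof (rule nn_integral_mono_AE, use u(2) in eventually_elim)
      case (elim x)
      then show ?case using u(1) p' by (auto simp: indicator_def intro!: ennreal_leI powr_mono2')
    qed
    also have "\<dots> = ennreal (u powr (- p')) * ennreal m"
      using m by (simp add: nn_integral_cmult_indicator)
    finally have "(\<integral>\<^sup>+x\<in>Q. ennreal (w x powr (- p')) \<partial>lebesgue) / emeasure lebesgue Q \<le> ennreal (u powr (- p'))"
      by (rule avg)
    from epowr_mono[OF this, of "q / p'"] show ?thesis
      using False q p' by (simp add: epowr_ennreal powr_powr p'_def[symmetric])
  qed
  then have "(\<integral>\<^sup>+x\<in>Q. ennreal (w x powr q) \<partial>lebesgue) / emeasure lebesgue Q * ?X
     \<le> ennreal (t * u powr q) * ennreal (u powr (- q))"
    by (intro mult_mono avg int) auto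
  also have "\<dots> = ennreal t"
    using t u(1) by (subst ennreal_mult[symmetric]) (auto simp: powr_minus)
  finally show "(\<integral>\<^sup>+x\<in>Q. ennreal (w x powr q) \<partial>lebesgue) / emeasure lebesgue Q * ?X \<le> ennreal t" .
qed

text \<open>On a cube where the weight is 1 both factors equal 1, which avoids Hoelder's inequality
  for general weights.\<close>

lemma Apq_const_ge_1:
  fixes w :: "real ^ 'n::finite \<Rightarrow> real"
  assumes D: "dyadic_grid D" and R: "R \<in> D" and w: "\<And>x. x \<in> R \<Longrightarrow> w x = 1"
  shows "1 \<le> Apq_const D p q w"
proof -
  obtain m where m: "0 < m" "emeasure lebesgue R = ennreal m" and [measurable]: "R \<in> sets lebesgue"
    using emeasure_grid_cube[OF D R] by metis
  have avg: "(\<integral>\<^sup>+x\<in>R. ennreal (w x powr b) \<partial>lebesgue) / emeasure lebesgue R = 1" for b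
  proof -
    have "(\<integral>\<^sup>+x\<in>R. ennreal (w x powr b) \<partial>lebesgue) = (\<integral>\<^sup>+x. indicator R x \<partial>lebesgue)"
      by (rule nn_integral_cong) (auto simp: indicator_def w)
    then show ?thesis using m by simp
  qed
  have "esssup (restrict_space lebesgue R) (\<lambda>x. ennreal (inverse (w x))) = 1"
  proof -
    have "esssup (restrict_space lebesgue R) (\<lambda>x. ennreal (inverse (w x)))
        = esssup (restrict_space lebesgue R) (\<lambda>x. 1)"
    proof (rule esssup_AE_cong)
      show "(\<lambda>x. ennreal (inverse (w x))) \<in> borel_measurable (restrict_space lebesgue R)"
        by (subst measurable_cong[of _ _ "\<lambda>x. 1"]) (auto simp: w space_restrict_space)
    qed (auto simp: AE_restrict_space_iff w)
    also have "\<dots> = 1"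
      using m by (intro esssup_const) (auto simp: space_restrict_space emeasure_restrict_space)
    finally show ?thesis .
  qed
  moreover have "epowr 1 b = 1" for b using epowr_ennreal[of 1 b] by simp
  ultimately show ?thesis
    unfolding Apq_const_def
    by (intro SUP_upper2[OF R]) (simp only: avg Let_def if_cancel mult_1_left order_refl)
qed

lemma power_powr: "0 < x \<Longrightarrow> (x ^ n) powr a = (x powr a) ^ n" for x :: real
  by (simp add: powr_realpow[symmetric] powr_powr mult.commute)

text \<open>Grid cubes are of three kinds: missing \<open>a\<close>, equal to some
  \<open>dyad a k\<close>, or containing the unit cube. The lower bounds \<open>u\<close> are
  respectively the constant value of the weight, \<open>v ^ k\<close>, and 1.\<close>

lemma Apq_lev_le:
  fixes a :: "real ^ 'n::finite"
  defines "\<theta> \<equiv> (1/2) ^ CARD('n)"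
  assumes D: "dyadic_grid D" "dyad a 0 \<in> D" and p: "1 \<le> p" and q: "0 < q" and v: "1 \<le> v"
    and v\<theta>: "v powr q * \<theta> < 1"
  shows "Apq_const D p q (\<lambda>x. v ^ lev a x) \<le> ennreal ((1 - \<theta>) / (1 - v powr q * \<theta>))"
proof (rule Apq_const_le[OF D(1) p q])
  define c where "c = v powr q"
  define t where "t = (1 - \<theta>) / (1 - c * \<theta>)"
  have c: "1 \<le> c" "c * \<theta> < 1" using v q v\<theta> by (auto simp: c_def ge_one_powr_ge_zero)
  have th: "0 < \<theta>" by (simp add: \<theta>_def)
  then have "\<theta> \<le> c * \<theta>" using c by simp
  then have t: "1 \<le> t" unfolding t_def using c by (simp add: field_simps)
  then show "0 \<le> (1 - \<theta>) / (1 - v powr q * \<theta>)" by (simp add: t_def c_def)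
  show "(\<lambda>x. v ^ lev a x) \<in> borel_measurable lebesgue" by measurable
  fix Q assume Q: "Q \<in> D"
  obtain m where m: "0 < m" "emeasure lebesgue Q = ennreal m" and [measurable]: "Q \<in> sets lebesgue"
    using emeasure_grid_cube[OF D(1) Q] by metis
  have wq: "(v ^ n) powr q = c ^ n" for n using v by (simp add: c_def power_powr)
  have "\<exists>u>0. (AE x in lebesgue. x \<in> Q \<longrightarrow> u \<le> v ^ lev a x) \<and>
     (\<integral>\<^sup>+x\<in>Q. ennreal (c ^ lev a x) \<partial>lebesgue) \<le> ennreal (t * u powr q) * emeasure lebesgue Q"
  proof (cases "a \<in> Q")
    case False
    define n where "n = lev a (SOME x. x \<in> Q)"
    have n: "lev a x = n" if "x \<in> Q" for x
      unfolding n_def using lev_const_on_grid_cube[OF D Q False that] someI[of "\<lambda>x. x \<in> Q", OF that] by blast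
    have "(\<integral>\<^sup>+x\<in>Q. ennreal (c ^ lev a x) \<partial>lebesgue) = (\<integral>\<^sup>+x\<in>Q. ennreal (c ^ n) \<partial>lebesgue)"
      by (rule nn_integral_cong) (auto simp: indicator_def n)
    also have "\<dots> = ennreal (c ^ n) * emeasure lebesgue Q" by (rule nn_integral_cmult_indicator) simp
    also have "\<dots> \<le> ennreal (t * (v ^ n) powr q) * emeasure lebesgue Q"
      using t c by (intro mult_right_mono ennreal_leI) (auto simp: wq)
    finally show ?thesis using v n by (intro exI[of _ "v ^ n"]) auto
  next
    case True
    then consider k where "Q = dyad a k" | "dyad a 0 \<subseteq> Q"
      using grid_cube_at_corner[OF D Q] by blast
    then show ?thesis
    proof cases
      case 1
      \<comment> \<open>The geometric series makes the average of \<open>c ^ lev a x\<close> over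
        this cube exactly \<open>t * c ^ k\<close>, so the bound by \<open>t\<close> is attained
        here.\<close>
      have "AE x in lebesgue. x \<in> Q \<longrightarrow> v ^ k \<le> v ^ lev a x"
        using AE_not_corner[of a] by eventually_elim (auto simp: 1 v lev_ge intro!: power_increasing)
      moreover have "(\<integral>\<^sup>+x\<in>Q. ennreal (c ^ lev a x) \<partial>lebesgue) = ennreal (t * (v ^ k) powr q) * emeasure lebesgue Q"
      proof -
        have "(\<integral>\<^sup>+x\<in>Q. ennreal (c ^ lev a x) \<partial>lebesgue) = ennreal (t * c ^ k * \<theta> ^ k)"
          using nn_integral_lev_power[of c a k] c by (simp add: 1 \<theta>_def t_def power_mult_distrib mult.assoc)
        also have "\<dots> = ennreal (t * c ^ k) * ennreal (\<theta> ^ k)"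
          using t c th by (intro ennreal_mult) auto
        finally show ?thesis by (simp only: 1 wq emeasure_dyad \<theta>_def)
      qed
      ultimately show ?thesis using v by (intro exI[of _ "v ^ k"]) auto
    next
      case 2
      \<comment> \<open>The integrand is 1, hence at most \<open>t\<close>, off the unit cube, and
        has average exactly \<open>t\<close> on it.\<close>
      have "(\<integral>\<^sup>+x\<in>Q. ennreal (c ^ lev a x) \<partial>lebesgue)
        \<le> (\<integral>\<^sup>+x. ennreal t * indicator (Q - dyad a 0) x + ennreal (c ^ lev a x) * indicator (dyad a 0) x \<partial>lebesgue)"
        using t by (intro nn_integral_mono) (auto simp: indicator_def lev_outside)
      also have "\<dots> = ennreal t * emeasure lebesgue (Q - dyad a 0) + (\<integral>\<^sup>+x\<in>dyad a 0. ennreal (c ^ lev a x) \<partial>lebesgue)"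
        by (subst nn_integral_add) (auto simp: nn_integral_cmult_indicator)
      also have "(\<integral>\<^sup>+x\<in>dyad a 0. ennreal (c ^ lev a x) \<partial>lebesgue) = ennreal t * emeasure lebesgue (dyad a 0)"
        using nn_integral_lev_power[of c a 0] c unfolding emeasure_dyad by (simp add: \<theta>_def t_def)
      also have "ennreal t * emeasure lebesgue (Q - dyad a 0) + \<dots> = ennreal t * emeasure lebesgue Q"
      proof -
        have "emeasure lebesgue (Q - dyad a 0) + emeasure lebesgue (dyad a 0) = emeasure lebesgue Q"
          using 2 by (subst plus_emeasure) (auto simp: Un_absorb2 simp del: emeasure_completion)
        then show ?thesis by (metis distrib_left)
      qed
      finally show ?thesis using v by (intro exI[of _ 1]) (auto intro!: AE_I2)
    qed
  qed
  then show "\<exists>u>0. (AE x in lebesgue. x \<in> Q \<longrightarrow> u \<le> v ^ lev a x) \<and>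
     (\<integral>\<^sup>+x\<in>Q. ennreal ((v ^ lev a x) powr q) \<partial>lebesgue)
       \<le> ennreal ((1 - \<theta>) / (1 - v powr q * \<theta>) * u powr q) * emeasure lebesgue Q"
    by (simp only: wq t_def c_def)
qed

lemma obtain_unit_cube:
  assumes "dyadic_grid D"
  obtains b where "x \<in> dyad b 0" "dyad b 0 \<in> D"
proof -
  have "partition_on UNIV {Q \<in> D. \<exists>b. Q = cube b (2 powi 0)}"
    using assms unfolding dyadic_grid_def by blast
  then have "x \<in> \<Union> {Q \<in> D. \<exists>b. Q = cube b (2 powi 0)}" by (simp add: partition_on_def)
  then show ?thesis using that by (auto simp: dyad_def)
qed

lemma Apq_lev_ge_1:
  fixes a :: "real ^ 'n::finite"
  assumes D: "dyadic_grid D" "dyad a 0 \<in> D"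
  shows "1 \<le> Apq_const D p q (\<lambda>x. v ^ lev a x)"
proof -
  \<comment> \<open>Here \<open>1\<close> is the all-ones vector, so \<open>a - 1\<close> lies
    outside the unit cube at \<open>a\<close>. The unit grid cube around it is therefore disjoint
    from that cube, and the weight is 1 there.\<close>
  obtain b where b: "a - 1 \<in> dyad b 0" "dyad b 0 \<in> D" using obtain_unit_cube[OF D(1)] by metis
  have "a - 1 \<notin> dyad a 0" by (auto simp: dyad_def cube_def)
  then have "dyad b 0 \<noteq> dyad a 0" using b by auto
  moreover have "partition_on UNIV {Q \<in> D. \<exists>b. Q = cube b (2 powi 0)}"
    using D unfolding dyadic_grid_def by blast
  moreover have "\<exists>x. dyad c 0 = cube x (2 powi 0)" for c :: "real ^ 'n" by (auto simp: dyad_def)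
  ultimately have "dyad b 0 \<inter> dyad a 0 = {}"
    using D b disjointD[OF partition_onD2, of UNIV "{Q \<in> D. \<exists>b. Q = cube b (2 powi 0)}" "dyad b 0" "dyad a 0"]
    by simp
  then have "lev a x = 0" if "x \<in> dyad b 0" for x using that lev_outside by blast
  then show ?thesis by (intro Apq_const_ge_1[OF D(1) b(2)]) simp
qed

section \<open>Averages and norms of the test function\<close>

lemma frac_avg_lev_ge_1:
  fixes a :: "real ^ 'n::finite"
  assumes "0 \<le> \<alpha>"
  shows "1 \<le> frac_avg \<alpha> (dyad a k) (\<lambda>x. (2 powr \<alpha>) ^ lev a x * indicator (dyad a 0) x)"
proof -
  let ?f = "\<lambda>x. (2 powr \<alpha>) ^ lev a x * indicator (dyad a 0) x"
  let ?d = "real CARD('n)"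
  have d: "0 < ?d" by simp
  have em: "emeasure lebesgue (dyad a k) = ennreal (2 powr (- ?d * k))"
    unfolding emeasure_dyad
    by (simp add: powr_minus powr_realpow powr_powr[symmetric] power_one_over inverse_eq_divide)
  then have m: "measure lebesgue (dyad a k) = 2 powr (- ?d * k)" unfolding measure_def by simp
  \<comment> \<open>Almost everywhere on \<open>dyad a k\<close> the function is at least
    \<open>2 powr (\<alpha> * k)\<close>. As the cube has measure \<open>2 powr (- d * k)\<close>,
    the product is precisely the normalising factor of the fractional average.\<close>
  have "ennreal ((2 powr \<alpha>) ^ k) * emeasure lebesgue (dyad a k) = (\<integral>\<^sup>+x\<in>dyad a k. ennreal ((2 powr \<alpha>) ^ k) \<partial>lebesgue)"
    by (simp add: nn_integral_cmult_indicator)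
  also have "\<dots> \<le> (\<integral>\<^sup>+x\<in>dyad a k. ennreal (?f x) \<partial>lebesgue)"
  proof (rule nn_integral_mono_AE, use AE_not_corner[of a] in eventually_elim)
    case (elim x)
    have "(2 powr \<alpha>) ^ k \<le> (2 powr \<alpha>) ^ lev a x" if "x \<in> dyad a k"
      using that elim lev_ge[of x a k] assms by (intro power_increasing) (auto simp: ge_one_powr_ge_zero)
    then show ?case using dyad_antimono[of 0 k a] by (auto simp: indicator_def ennreal_leI)
  qed
  finally have "ennreal ((2 powr \<alpha>) ^ k * 2 powr (- ?d * k)) \<le> (\<integral>\<^sup>+x\<in>dyad a k. ennreal (?f x) \<partial>lebesgue)"
    unfolding em by (subst ennreal_mult) auto
  moreover have "(2 powr \<alpha>) ^ k * 2 powr (- ?d * k) = measure lebesgue (dyad a k) powr (1 - \<alpha> / ?d)"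
  proof -
    have "\<alpha> * k + (- ?d * k) = (- ?d * k) * (1 - \<alpha> / ?d)" using d by (simp add: algebra_simps)
    moreover have "(2 powr \<alpha>) ^ k = 2 powr (\<alpha> * k)" by (simp add: powr_powr[symmetric] powr_realpow)
    ultimately show ?thesis unfolding m by (simp only: powr_powr powr_add[symmetric])
  qed
  ultimately have "ennreal (measure lebesgue (dyad a k) powr (1 - \<alpha> / ?d)) \<le> (\<integral>\<^sup>+x\<in>dyad a k. ennreal (?f x) \<partial>lebesgue)"
    by (simp only:)
  from divide_right_mono_ennreal[OF this]
  have "ennreal c / ennreal c \<le> frac_avg \<alpha> (dyad a k) ?f" if "c = measure lebesgue (dyad a k) powr (1 - \<alpha> / ?d)" for c
    unfolding that frac_avg_def .
  moreover have "0 < measure lebesgue (dyad a k) powr (1 - \<alpha> / ?d)" unfolding m by simp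
  ultimately show ?thesis by simp
qed

lemma emeasure_weighted_dyad:
  fixes a :: "real ^ 'n::finite"
  defines "\<theta> \<equiv> (1/2) ^ CARD('n)"
  assumes "0 < v" "v powr q * \<theta> < 1"
  shows "emeasure (weighted_measure (\<lambda>x. v ^ lev a x) q) (dyad a n)
    = ennreal ((1 - \<theta>) * (v powr q * \<theta>) ^ n / (1 - v powr q * \<theta>))"
proof -
  have "emeasure (weighted_measure (\<lambda>x. v ^ lev a x) q) (dyad a n)
    = (\<integral>\<^sup>+x\<in>dyad a n. ennreal ((v powr q) ^ lev a x) \<partial>lebesgue)"
    unfolding weighted_measure_def using assms(2) by (subst emeasure_density) (auto simp: power_powr)
  then show ?thesis using assms by (simp add: nn_integral_lev_power)
qed

text \<open>The product of weight and function is again a power of the level, with base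
  \<open>v * s\<close>, on the unit cube. The indicator is essential: outside that cube both powers
  are 1, and the integral would diverge.\<close>

lemma Lp_lev:
  fixes a :: "real ^ 'n::finite"
  defines "\<theta> \<equiv> (1/2) ^ CARD('n)"
  assumes "0 < v" "0 < s" "(v * s) powr p * \<theta> < 1" "0 < p"
  defines "f \<equiv> \<lambda>x. s ^ lev a x * indicator (dyad a 0) x"
    and "M \<equiv> weighted_measure (\<lambda>x. v ^ lev a x) p"
  shows "Lp_norm M p f = ennreal (((1 - \<theta>) / (1 - (v * s) powr p * \<theta>)) powr (1 / p))"
    and "f \<in> Lp_space M p"
proof -
  have [measurable]: "f \<in> borel_measurable lebesgue" unfolding f_def by measurable
  have "(\<integral>\<^sup>+x. ennreal (\<bar>f x\<bar> powr p) \<partial>M)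
      = (\<integral>\<^sup>+x. ennreal ((v ^ lev a x) powr p) * ennreal (\<bar>f x\<bar> powr p) \<partial>lebesgue)"
    unfolding M_def weighted_measure_def by (subst nn_integral_density) auto
  also have "\<dots> = (\<integral>\<^sup>+x\<in>dyad a 0. ennreal (((v * s) powr p) ^ lev a x) \<partial>lebesgue)"
    using assms(2,3,5)
    by (intro nn_integral_cong)
       (auto simp: f_def indicator_def power_powr powr_mult power_mult_distrib ennreal_mult)
  also have "\<dots> = ennreal ((1 - \<theta>) / (1 - (v * s) powr p * \<theta>))"
    using assms(4) by (subst nn_integral_lev_power) (auto simp: \<theta>_def)
  finally show norm: "Lp_norm M p f = ennreal (((1 - \<theta>) / (1 - (v * s) powr p * \<theta>)) powr (1 / p))"
    unfolding Lp_norm_def using assms(4)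
    by (simp add: epowr_ennreal \<theta>_def power_le_one)
  show "f \<in> Lp_space M p"
    using norm by (simp add: Lp_space_def) (simp add: M_def weighted_measure_def)
qed

section \<open>Combination of the weight, the test function and the sparse family\<close>

theorem theorem4p12:
  fixes D :: "(real ^ 'n::finite) set set"
    and \<nu> \<alpha> p q \<gamma> :: real
    and \<Phi> :: "real \<Rightarrow> real"
  assumes "dyadic_grid D"
    and "0 < \<gamma>" and "\<gamma> < 1"
    and "1 \<le> \<nu>"
    and "0 \<le> \<alpha>" and "\<alpha> < real CARD('n)"
    and "1 \<le> p" and "p \<le> q"
    and "1 / q + \<alpha> / real CARD('n) = 1 / p"
    and "mono_on {1..} \<Phi>"
    and "\<And>w S. weight w \<Longrightarrow> Apq_const D p q w < \<infinity> \<Longrightarrow> S \<subseteq> D \<Longrightarrow> sparse_family \<gamma> S \<Longrightarrow>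
           strong_weak_norm p q w (sparse_op \<alpha> \<nu> S)
             \<le> ennreal (\<Phi> (enn2real (Apq_const D p q w)))"
  shows "\<exists>c>0. \<forall>t\<ge>1. \<Phi> t \<ge> c * t powr (1 / \<nu> - \<alpha> / real CARD('n))"
proof -
  let ?d = "real CARD('n)"
  define \<theta> :: real where "\<theta> = (1/2) ^ CARD('n)"
  have th: "0 < \<theta>" "\<theta> < 1" by (auto simp: \<theta>_def power_less_one_iff)
  have q: "1 \<le> q" using assms by simp
  obtain a :: "real ^ 'n" where a: "dyad a 0 \<in> D" using obtain_unit_cube[OF assms(1), of 0] by metis
  \<comment> \<open>Any fixed sparseness parameter is reached by skipping \<open>m\<close>
    generations; \<open>m = 0\<close> is excluded since it would give
    \<open>1 < 1 - \<gamma>\<close>.\<close>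
  obtain m where m: "\<theta> ^ m < 1 - \<gamma>" using real_arch_pow_inv[of "1 - \<gamma>" \<theta>] th assms by auto
  then have m0: "0 < m" using assms(2) by (cases m) auto
  define S where "S = range (\<lambda>k. dyad a (m * k))"
  have S: "S \<subseteq> D" "countable S" "sparse_family \<gamma> S"
    using dyad_in_grid[OF assms(1) a] sparse_family_dyads[OF m0, of \<gamma> a] m assms(2)
    by (auto simp: S_def \<theta>_def)
  \<comment> \<open>A lower bound for \<open>r ^ (m * k)\<close> uniform in \<open>t\<close>. The
    constant \<open>c\<close> then collects all factors free of \<open>t\<close>: this one, the 2
    lost in the weak norm, and \<open>q / p\<close> from the norm of the test function.\<close>
  define c0 where "c0 = exp (- (m * (1 - \<theta>) / \<theta>))"
  define c where "c = c0 powr (1 / q) / (2 * (q / p) powr (1 / p))"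
  have c: "0 < c" using assms(7,8) by (simp add: c_def c0_def)
  have "c * t powr (1 / \<nu> - \<alpha> / ?d) \<le> \<Phi> t" if t: "1 \<le> t" for t
  proof -
    \<comment> \<open>Solves \<open>(1 - \<theta>) / (1 - r) = t\<close>, the bound of
      \<open>Apq_lev_le\<close>. Since \<open>t \<ge> 1\<close>, \<open>r \<ge> \<theta>\<close> and
      hence \<open>v \<ge> 1\<close>; at \<open>t = 1\<close> the weight is identically 1.\<close>
    define r where "r = 1 - (1 - \<theta>) / t"
    have "(1 - \<theta>) / t \<le> 1 - \<theta>" using divide_left_mono[of 1 t "1 - \<theta>"] t th by simp
    then have r: "\<theta> \<le> r" "r < 1" "0 < r" using th t by (auto simp: r_def)
    have rt: "(1 - \<theta>) / (1 - r) = t" using t th by (simp add: r_def)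
    define v where "v = (r / \<theta>) powr (1 / q)"
    have vq: "v powr q = r / \<theta>" "v powr q * \<theta> = r"
      using q r th by (auto simp: v_def powr_powr)
    have v: "1 \<le> v" using r th q by (auto simp: v_def intro!: ge_one_powr_ge_zero)
    \<comment> \<open>A weight must be locally integrable itself, not only its \<open>q\<close>-th
      power; this follows from \<open>v \<le> v powr q\<close>.\<close>
    have "v powr 1 \<le> v powr q" using v q by (rule powr_mono[rotated])
    then have "v * \<theta> \<le> v powr q * \<theta>" using v th by (intro mult_right_mono) auto
    then have v1: "v * \<theta> < 1" using vq r by simp
    define w where "w = (\<lambda>x. v ^ lev a x)"
    define f where "f = (\<lambda>x. (2 powr \<alpha>) ^ lev a x * indicator (dyad a 0) x)"
    have w: "weight w" unfolding w_def using weight_lev[of v a] v v1 by (simp add: \<theta>_def)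
    have At: "Apq_const D p q w \<le> ennreal t"
      using Apq_lev_le[OF assms(1) a assms(7), of q v] q v vq(2) r rt unfolding w_def by (simp add: \<theta>_def)
    have A1: "1 \<le> Apq_const D p q w" unfolding w_def by (rule Apq_lev_ge_1[OF assms(1) a])
    have Afin: "Apq_const D p q w < \<infinity>" using At by (simp add: le_less_trans)
    define A where "A = enn2real (Apq_const D p q w)"
    have A: "1 \<le> A" "A \<le> t"
      using enn2real_mono[OF A1] enn2real_mono[OF At] Afin t by (auto simp: A_def)

    \<comment> \<open>Norm of the test function\<close>
    have s: "(v * 2 powr \<alpha>) powr p * \<theta> = r powr (p / q)"
    proof -
      have \<theta>: "\<theta> = 2 powr (- ?d)"
        by (simp add: \<theta>_def powr_minus powr_realpow power_one_over inverse_eq_divide)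
      \<comment> \<open>The scaling relation between the exponents: the powers of
        \<open>\<theta>\<close> coming from the weight, the function and the shells cancel and leave
        \<open>r powr (p / q)\<close>.\<close>
      have "\<alpha> * p = - ?d * (p / q - 1)" using assms(6-9) by (simp add: field_simps)
      then have "(2 powr \<alpha>) powr p = \<theta> powr (p / q - 1)"
        unfolding \<theta> powr_powr by (simp only:)
      then have "(v * 2 powr \<alpha>) powr p * \<theta> = (r / \<theta>) powr (p / q) * \<theta> powr (p / q - 1) * \<theta> powr 1"
        using th v by (simp add: powr_mult v_def powr_powr)
      also have "\<dots> = (r / \<theta>) powr (p / q) * \<theta> powr (p / q)"
        by (simp only: powr_add[symmetric] mult.assoc diff_add_cancel)
      also have "\<dots> = r powr (p / q)" using r th by (simp add: powr_divide)
      finally show ?thesis .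
    qed
    have pq: "0 < p / q" "p / q \<le> 1" using assms by auto
    have r1: "r powr (p / q) < 1" using r pq powr_less_mono2[of "p / q" r 1] by simp
    \<comment> \<open>Concavity of \<open>x powr (p / q)\<close>, as weighted AM-GM with second
      number 1, turns \<open>1 - r powr (p / q)\<close> into a multiple of \<open>1 - r\<close>,
      hence of \<open>1 / t\<close>.\<close>
    have "r powr (p / q) * 1 powr (1 - p / q) \<le> p / q * r + (1 - p / q) * 1"
      using pq r by (intro Youngs_inequality_0) auto
    then have "p / q * (1 - r) \<le> 1 - r powr (p / q)" by (simp add: right_diff_distrib diff_divide_distrib)
    then have "(1 - \<theta>) / (1 - r powr (p / q)) \<le> (1 - \<theta>) / (p / q * (1 - r))"
      using th mult_pos_pos[OF pq(1), of "1 - r"] r by (intro frac_le) auto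
    also have "\<dots> = q / p * t" using rt by (simp flip: rt)
    finally have J: "(1 - \<theta>) / (1 - r powr (p / q)) \<le> q / p * t" .
    have f: "f \<in> Lp_space (weighted_measure w p) p"
      unfolding f_def w_def using Lp_lev(2)[of v "2 powr \<alpha>" p a] v assms(7) s r1 by (simp add: \<theta>_def)
    have fN: "Lp_norm (weighted_measure w p) p f \<le> ennreal ((q / p * t) powr (1 / p))"
    proof -
      have "Lp_norm (weighted_measure w p) p f = ennreal (((1 - \<theta>) / (1 - r powr (p / q))) powr (1 / p))"
        unfolding f_def w_def using Lp_lev(1)[of v "2 powr \<alpha>" p a] v assms(7) s r1 by (simp add: \<theta>_def)
      then show ?thesis using J th r1 assms(7) by (auto intro!: ennreal_leI powr_mono2)
    qed

    \<comment> \<open>Weak norm of the sparse operator\<close>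
    define k where "k = nat \<lfloor>t\<rfloor>"
    \<comment> \<open>The upper bound on \<open>k\<close> keeps the mass of
      \<open>dyad a (m * k)\<close> comparable to \<open>t\<close>; the lower bound supplies at
      least \<open>t\<close> nested cubes.\<close>
    have k: "real k \<le> t" "t \<le> real (Suc k)" using t by (auto simp: k_def) linarith
    have rk: "c0 \<le> r ^ (m * k)"
    proof -
      \<comment> \<open>The inequality \<open>1 + x \<le> exp x\<close> bounds \<open>r\<close>
        below by an exponential. Since \<open>r \<ge> \<theta>\<close> and
        \<open>1 - r = (1 - \<theta>) / t\<close>, its exponent is of order \<open>1 / t\<close>,
        which \<open>k \<le> t\<close> absorbs in the power \<open>m * k\<close>.\<close>
      have "1 / r \<le> exp (1 / r - 1)" using exp_ge_add_one_self[of "1 / r - 1"] by simp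
      then have "1 / exp (1 / r - 1) \<le> r" using r by (simp add: field_simps)
      then have "exp (- (1 / r - 1)) \<le> r" unfolding exp_minus by (simp only: inverse_eq_divide)
      then have pw: "exp (- (1 / r - 1)) ^ (m * k) \<le> r ^ (m * k)" by (rule power_mono) simp
      have "1 / r - 1 = (1 - r) / r" using r by (simp add: field_simps)
      moreover have "(1 - r) / r \<le> (1 - r) / \<theta>" using r th by (intro divide_left_mono) auto
      moreover have "1 - r = (1 - \<theta>) / t" by (simp add: r_def)
      ultimately have *: "1 / r - 1 \<le> (1 - \<theta>) / t / \<theta>" by simp
      have "real (m * k) * (1 / r - 1) \<le> real (m * k) * ((1 - \<theta>) / t / \<theta>)"
        using * by (rule mult_left_mono) simp
      also have "\<dots> = real m * (1 - \<theta>) / \<theta> * (real k / t)" by (simp add: mult_ac)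
      also have "\<dots> \<le> real m * (1 - \<theta>) / \<theta> * 1" using k th t by (intro mult_left_mono) auto
      finally have "c0 \<le> exp (- (real (m * k) * (1 / r - 1)))" by (simp add: c0_def)
      also have "\<dots> = exp (- (1 / r - 1)) ^ (m * k)"
        by (simp only: exp_of_nat_mult[symmetric] mult_minus_right)
      finally show ?thesis using pw by (rule order_trans)
    qed
    \<comment> \<open>The cubes with \<open>j = 0, ..., k\<close> all contain
      \<open>dyad a (m * k)\<close>; these \<open>k + 1\<close> terms are each at least 1
      there.\<close>
    define l where "l = real (Suc k) powr (1 / \<nu>)"
    have "ennreal (l / 2 * (t * c0) powr (1 / q)) \<le> weak_Lq_norm (weighted_measure w q) q (sparse_op \<alpha> \<nu> S f)"
    proof (rule weak_Lq_norm_ge)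
      show "dyad a (m * k) \<in> sets (weighted_measure w q)" by (simp add: weighted_measure_def)
      have "emeasure (weighted_measure w q) (dyad a (m * k)) = ennreal (t * r ^ (m * k))"
        unfolding w_def using emeasure_weighted_dyad[of v q a "m * k"] v vq(2) r rt
        by (simp add: \<theta>_def) (metis times_divide_eq_left)
      then show "ennreal (t * c0) \<le> emeasure (weighted_measure w q) (dyad a (m * k))"
        using rk t by (auto intro!: ennreal_leI)
      show "0 \<le> t * c0" using t by (simp add: c0_def)
      show "0 < l" by (simp add: l_def)
      show "0 < q" using q by simp
      have "sparse_op \<alpha> \<nu> S f \<in> borel_measurable lebesgue"
        using S(2) by (rule sparse_op_measurable) (auto simp: S_def)
      then show "sparse_op \<alpha> \<nu> S f \<in> borel_measurable (weighted_measure w q)"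
        by (simp add: weighted_measure_def)
      fix x assume x: "x \<in> dyad a (m * k)"
      let ?F = "(\<lambda>j. dyad a (m * j)) ` {..k}"
      have "inj_on (\<lambda>j. dyad a (m * j)) {..k}"
        using m0 by (auto intro!: inj_onI dest: injD[OF inj_dyad])
      then have "card ?F = Suc k" by (simp add: card_image)
      moreover have "x \<in> dyad a (m * j)" if "j \<le> k" for j
        using x dyad_antimono[of "m * j" "m * k" a] that by auto
      ultimately show "ennreal l \<le> sparse_op \<alpha> \<nu> S f x"
        using sparse_op_ge[of ?F S \<nu> \<alpha> f x] frac_avg_lev_ge_1[OF assms(5), of a] assms(4)
        by (force simp: l_def S_def f_def)
    qed
    then have "ennreal (l / 2 * (t * c0) powr (1 / q) / (q / p * t) powr (1 / p))
        \<le> strong_weak_norm p q w (sparse_op \<alpha> \<nu> S)"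
      using assms(7,8) t by (intro strong_weak_norm_ge[OF f _ fN]) (auto simp: f_def l_def)
    also have "\<dots> \<le> ennreal (\<Phi> A)"
      unfolding A_def by (rule assms(11)[OF w Afin S(1,3)])
    finally have main: "ennreal (l / 2 * (t * c0) powr (1 / q) / (q / p * t) powr (1 / p)) \<le> ennreal (\<Phi> A)" .

    \<comment> \<open>Comparison of exponents\<close>
    have "c * t powr (1 / \<nu> - \<alpha> / ?d) = t powr (1 / \<nu>) / 2 * (t * c0) powr (1 / q) / (q / p * t) powr (1 / p)"
    proof -
      have "1 / \<nu> - \<alpha> / ?d = 1 / \<nu> + 1 / q - 1 / p" using assms(9) by simp
      then have "t powr (1 / \<nu> - \<alpha> / ?d) = t powr (1 / \<nu>) * t powr (1 / q) / t powr (1 / p)"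
        by (simp only: powr_add powr_diff)
      moreover have "(t * c0) powr (1 / q) = t powr (1 / q) * c0 powr (1 / q)"
        "(q / p * t) powr (1 / p) = (q / p) powr (1 / p) * t powr (1 / p)"
        using t assms(7,8) by (intro powr_mult; simp add: c0_def)+
      ultimately show ?thesis unfolding c_def by (simp only: times_divide_eq_left times_divide_eq_right divide_divide_eq_left mult_ac)
    qed
    also have "\<dots> \<le> l / 2 * (t * c0) powr (1 / q) / (q / p * t) powr (1 / p)"
      unfolding l_def using k(2) t assms(4) by (intro divide_right_mono mult_right_mono powr_mono2) auto
    finally have "ennreal (c * t powr (1 / \<nu> - \<alpha> / ?d)) \<le> ennreal (\<Phi> A)"
      using main by (meson ennreal_leI order_trans)
    \<comment> \<open>\<open>\<Phi>\<close> could be negative a priori, and \<open>ennreal\<close>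
      sends negative numbers to 0; positivity of the left side excludes this.\<close>
    moreover have "0 < c * t powr (1 / \<nu> - \<alpha> / ?d)" using c t by simp
    ultimately have "c * t powr (1 / \<nu> - \<alpha> / ?d) \<le> \<Phi> A"
      by (cases "0 \<le> \<Phi> A") (auto simp: ennreal_neg)
    \<comment> \<open>Both bounds on \<open>A\<close> enter: \<open>1 \<le> A\<close> places it in
      the domain of monotonicity, and \<open>A \<le> t\<close> gives the comparison.\<close>
    also have "\<Phi> A \<le> \<Phi> t" using assms(10) A by (auto intro: mono_onD)
    finally show ?thesis .
  qed
  with c show ?thesis by blast
qed

end
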